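(* Let $R$ be a pseudomeadow and $I$ an ideal of $R$. Suppose that $I_{\mathfrak{m}}=(0)$ for every $\mathfrak{m}\in\mathrm{MaxSpec}(R)$. Then $I=(0)$.
   Context: A pseudoring is a commutative associative ring that is not required to have a multiplicative identity. A pseudomeadow is a pseudoring $R$ in which every $x\in R$ has a von Neumann inverse, i.e. an element $x^{(-1)}\in R$ (necessarily unique) with $x\,x\,x^{(-1)}=x$ and $x\,x^{(-1)}x^{(-1)}=x^{(-1)}$. An ideal $\mathfrak{m}$ is maximal if $\mathfrak{m}\ne R$ and every ideal $I\supseteq\mathfrak{m}$ satisfies $I=\mathfrak{m}$ or $I=R$; $\mathrm{MaxSpec}(R)$ is the set of maximal ideals. In a pseudomeadow every maximal ideal is prime (proper, and $xy\in\mathfrak{m}$ implies $x\in\mathfrak{m}$ or $y\in\mathfrak{m}$), so $R\setminus\mathfrak{m}$ is non-empty and multiplicatively closed. $R_{\mathfrak{m}}$ is the localization, defined as for rings: fractions $r/s$ with $r\in R$, $s\in R\setminus\mathfrak{m}$, where $r/s=r'/s'$ iff $(rs'-r's)u=0$ for some $u\in R\setminus\mathfrak{m}$, with the usual operations; it is a ring with identity $s/s$. For an ideal $I$ of $R$, $I_{\mathfrak{m}}=\{a/s: a\in I,\ s\in R\setminus\mathfrak{m}\}$, an ideal of $R_{\mathfrak{m}}$. *)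

theory Defs
  imports "HOL-Algebra.Ideal"
begin

section \<open>Pseudorings and pseudomeadows\<close>

text \<open>Pseudorings live on the \<open>ring\<close> records of HOL-Algebra, whose field \<open>one\<close> is left
  unconstrained here: it need not lie in the carrier and nothing refers to it. HOL-Algebra's
  \<open>ideal\<close> and \<open>maximalideal\<close> presuppose a unital ring, so they are restated below without
  that assumption.\<close>

locale pseudoring = abelian_group R for R (structure) +
  assumes m_closed: "\<lbrakk>x \<in> carrier R; y \<in> carrier R\<rbrakk> \<Longrightarrow> x \<otimes> y \<in> carrier R"
    and m_assoc:
      "\<lbrakk>x \<in> carrier R; y \<in> carrier R; z \<in> carrier R\<rbrakk> \<Longrightarrow> (x \<otimes> y) \<otimes> z = x \<otimes> (y \<otimes> z)"
    and m_comm: "\<lbrakk>x \<in> carrier R; y \<in> carrier R\<rbrakk> \<Longrightarrow> x \<otimes> y = y \<otimes> x"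
    and l_distr:
      "\<lbrakk>x \<in> carrier R; y \<in> carrier R; z \<in> carrier R\<rbrakk> \<Longrightarrow> (x \<oplus> y) \<otimes> z = x \<otimes> z \<oplus> y \<otimes> z"

locale pseudomeadow = pseudoring +
  assumes von_Neumann_inverse:
    "x \<in> carrier R \<Longrightarrow> \<exists>y \<in> carrier R. x \<otimes> x \<otimes> y = x \<and> x \<otimes> y \<otimes> y = y"

locale pseudo_ideal = additive_subgroup I R + pseudoring R for I and R (structure) +
  assumes absorb: "\<lbrakk>a \<in> I; x \<in> carrier R\<rbrakk> \<Longrightarrow> x \<otimes> a \<in> I"

locale maximal_pseudo_ideal = pseudo_ideal M R for M and R (structure) +
  assumes proper: "M \<noteq> carrier R"
    and maximal: "\<lbrakk>pseudo_ideal J R; M \<subseteq> J\<rbrakk> \<Longrightarrow> J = M \<or> J = carrier R"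

definition MaxSpec :: "('a, 'b) ring_scheme \<Rightarrow> 'a set set" where
  "MaxSpec R = {M. maximal_pseudo_ideal M R}"


section \<open>Localization\<close>

text \<open>The fraction \<open>r/s\<close> with denominators in \<open>S\<close>, as its class of equivalent pairs.\<close>

definition fraction :: "('a, 'b) ring_scheme \<Rightarrow> 'a set \<Rightarrow> 'a \<Rightarrow> 'a \<Rightarrow> ('a \<times> 'a) set" where
  "fraction R S r s = {(r', s'). r' \<in> carrier R \<and> s' \<in> S \<and>
     (\<exists>u \<in> S. ((r \<otimes>\<^bsub>R\<^esub> s') \<ominus>\<^bsub>R\<^esub> (r' \<otimes>\<^bsub>R\<^esub> s)) \<otimes>\<^bsub>R\<^esub> u = \<zero>\<^bsub>R\<^esub>)}"

text \<open>The operations are given on classes as unions over all representatives; the lemmas below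
  show that they are the usual ones. For a pseudoring there is no \<open>1/1\<close>, and the identity and
  zero are the common classes of all \<open>s/s\<close> and of all \<open>0/s\<close>, respectively.\<close>

definition localization :: "('a, 'b) ring_scheme \<Rightarrow> 'a set \<Rightarrow> ('a \<times> 'a) set ring" where
  "localization R S = \<lparr>
     carrier = {fraction R S r s | r s. r \<in> carrier R \<and> s \<in> S},
     mult = (\<lambda>X Y. \<Union>(r, s) \<in> X. \<Union>(r', s') \<in> Y. fraction R S (r \<otimes>\<^bsub>R\<^esub> r') (s \<otimes>\<^bsub>R\<^esub> s')),
     one = (\<Union>s \<in> S. fraction R S s s),
     zero = (\<Union>s \<in> S. fraction R S \<zero>\<^bsub>R\<^esub> s),
     add = (\<lambda>X Y. \<Union>(r, s) \<in> X. \<Union>(r', s') \<in> Y.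
       fraction R S ((r \<otimes>\<^bsub>R\<^esub> s') \<oplus>\<^bsub>R\<^esub> (r' \<otimes>\<^bsub>R\<^esub> s)) (s \<otimes>\<^bsub>R\<^esub> s'))\<rparr>"

definition localization_at :: "('a, 'b) ring_scheme \<Rightarrow> 'a set \<Rightarrow> ('a \<times> 'a) set ring" where
  "localization_at R M = localization R (carrier R - M)"

definition ideal_localization_at ::
    "('a, 'b) ring_scheme \<Rightarrow> 'a set \<Rightarrow> 'a set \<Rightarrow> ('a \<times> 'a) set set" where
  "ideal_localization_at R M I =
     {fraction R (carrier R - M) a s | a s. a \<in> I \<and> s \<in> carrier R - M}"

context pseudoring
begin

lemma r_distr:
  "\<lbrakk>x \<in> carrier R; y \<in> carrier R; z \<in> carrier R\<rbrakk> \<Longrightarrow> z \<otimes> (x \<oplus> y) = z \<otimes> x \<oplus> z \<otimes> y"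
  by (metis l_distr m_comm a_closed)

lemma m_lcomm:
  "\<lbrakk>x \<in> carrier R; y \<in> carrier R; z \<in> carrier R\<rbrakk> \<Longrightarrow> x \<otimes> (y \<otimes> z) = y \<otimes> (x \<otimes> z)"
  by (metis m_assoc m_comm)

lemma l_null: "x \<in> carrier R \<Longrightarrow> \<zero> \<otimes> x = \<zero>"
  by (metis add.r_cancel_one' l_distr l_zero m_closed zero_closed)

lemma l_minus: "\<lbrakk>x \<in> carrier R; y \<in> carrier R\<rbrakk> \<Longrightarrow> (\<ominus> x) \<otimes> y = \<ominus> (x \<otimes> y)"
  by (metis a_inv_closed add.inv_equality l_distr l_neg l_null m_closed)

lemma minus_mult_eq_zero_iff:
  assumes "x \<in> carrier R" "y \<in> carrier R" "u \<in> carrier R"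
  shows "(x \<ominus> y) \<otimes> u = \<zero> \<longleftrightarrow> x \<otimes> u = y \<otimes> u"
  using assms
  by (simp add: a_minus_def l_distr l_minus m_closed)
     (metis add.inv_closed add.inv_equality add.inv_inv m_closed r_neg)

end

lemma UN_pairs_const:
  assumes "(a, b) \<in> X" "(a', b') \<in> Y"
    and "\<And>r s r' s'. (r, s) \<in> X \<Longrightarrow> (r', s') \<in> Y \<Longrightarrow> F r s r' s' = K"
  shows "(\<Union>(r, s) \<in> X. \<Union>(r', s') \<in> Y. F r s r' s') = K"
proof -
  have "(\<Union>(r, s) \<in> X. \<Union>(r', s') \<in> Y. F r s r' s') = (\<Union>p \<in> X. \<Union>q \<in> Y. K)"
    by (intro SUP_cong refl) (auto simp: assms(3) split: prod.splits)
  then show ?thesis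
    using assms(1,2) by auto
qed

locale multiplicative_set = pseudoring +
  fixes S
  assumes S_sub: "S \<subseteq> carrier R" and S_nonempty: "S \<noteq> {}"
    and S_mult: "\<lbrakk>s \<in> S; t \<in> S\<rbrakk> \<Longrightarrow> s \<otimes> t \<in> S"
begin

lemma S_carrier: "s \<in> S \<Longrightarrow> s \<in> carrier R"
  using S_sub by blast

lemma mem_frac:
  assumes "r \<in> carrier R" "s \<in> S"
  shows "(r', s') \<in> fraction R S r s \<longleftrightarrow>
    r' \<in> carrier R \<and> s' \<in> S \<and> (\<exists>u \<in> S. r \<otimes> s' \<otimes> u = r' \<otimes> s \<otimes> u)"
  using assms by (auto simp: fraction_def minus_mult_eq_zero_iff S_carrier m_closed)

lemma mem_fracI:
  assumes "r \<otimes> s' \<otimes> u = r' \<otimes> s \<otimes> u"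
    and "r \<in> carrier R" "s \<in> S" "r' \<in> carrier R" "s' \<in> S" "u \<in> S"
  shows "(r', s') \<in> fraction R S r s"
  using assms mem_frac[OF assms(2,3)] by blast

lemma frac_refl: "\<lbrakk>r \<in> carrier R; s \<in> S\<rbrakk> \<Longrightarrow> (r, s) \<in> fraction R S r s"
  using S_nonempty mem_fracI[of r s _ r s] by blast

lemma frac_eqI:
  assumes "(r', s') \<in> fraction R S r s" "r \<in> carrier R" "s \<in> S"
  shows "fraction R S r' s' = fraction R S r s"
proof -
  obtain u where u: "r' \<in> carrier R" "s' \<in> S" "u \<in> S" "r \<otimes> s' \<otimes> u = r' \<otimes> s \<otimes> u"
    using assms(1) mem_frac[OF assms(2,3)] by blast
  note c = assms(2,3) u(1-3) S_carrier m_closed S_mult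
  have "(a, b) \<in> fraction R S r' s' \<longleftrightarrow> (a, b) \<in> fraction R S r s" for a b
  proof
    assume "(a, b) \<in> fraction R S r' s'"
    then obtain v where v: "a \<in> carrier R" "b \<in> S" "v \<in> S" "r' \<otimes> b \<otimes> v = a \<otimes> s' \<otimes> v"
      using mem_frac[OF u(1,2)] by blast
    have "r \<otimes> b \<otimes> (s' \<otimes> u \<otimes> v) = (r \<otimes> s' \<otimes> u) \<otimes> (b \<otimes> v)"
      using c v by (simp add: m_assoc m_comm m_lcomm)
    also have "\<dots> = (r' \<otimes> b \<otimes> v) \<otimes> (s \<otimes> u)"
      unfolding u(4) using c v(1-3) by (simp add: m_assoc m_comm m_lcomm)
    also have "\<dots> = a \<otimes> s \<otimes> (s' \<otimes> u \<otimes> v)"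
      unfolding v(4) using c v(1-3) by (simp add: m_assoc m_comm m_lcomm)
    finally show "(a, b) \<in> fraction R S r s"
      by (rule mem_fracI) (simp_all add: c v(1-3))
  next
    assume "(a, b) \<in> fraction R S r s"
    then obtain v where v: "a \<in> carrier R" "b \<in> S" "v \<in> S" "r \<otimes> b \<otimes> v = a \<otimes> s \<otimes> v"
      using mem_frac[OF assms(2,3)] by blast
    have "r' \<otimes> b \<otimes> (s \<otimes> u \<otimes> v) = (r' \<otimes> s \<otimes> u) \<otimes> (b \<otimes> v)"
      using c v(1-3) by (simp add: m_assoc m_comm m_lcomm)
    also have "\<dots> = (r \<otimes> b \<otimes> v) \<otimes> (s' \<otimes> u)"
      unfolding u(4)[symmetric] using c v(1-3) by (simp add: m_assoc m_comm m_lcomm)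
    also have "\<dots> = a \<otimes> s' \<otimes> (s \<otimes> u \<otimes> v)"
      unfolding v(4) using c v(1-3) by (simp add: m_assoc m_comm m_lcomm)
    finally show "(a, b) \<in> fraction R S r' s'"
      by (rule mem_fracI) (simp_all add: c v(1-3))
  qed
  then show ?thesis by auto
qed

lemma mult_frac:
  assumes "r \<in> carrier R" "s \<in> S" "r' \<in> carrier R" "s' \<in> S"
  shows "fraction R S r s \<otimes>\<^bsub>localization R S\<^esub> fraction R S r' s' = fraction R S (r \<otimes> r') (s \<otimes> s')"
proof -
  have "fraction R S (a \<otimes> a') (b \<otimes> b') = fraction R S (r \<otimes> r') (s \<otimes> s')"
    if ab: "(a, b) \<in> fraction R S r s" "(a', b') \<in> fraction R S r' s'" for a b a' b'
  proof -
    obtain u v where u: "a \<in> carrier R" "b \<in> S" "u \<in> S" "r \<otimes> b \<otimes> u = a \<otimes> s \<otimes> u"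
      and v: "a' \<in> carrier R" "b' \<in> S" "v \<in> S" "r' \<otimes> b' \<otimes> v = a' \<otimes> s' \<otimes> v"
      using ab mem_frac[OF assms(1,2)] mem_frac[OF assms(3,4)] by blast
    note c = assms u(1-3) v(1-3) S_carrier m_closed S_mult
    have "(r \<otimes> r') \<otimes> (b \<otimes> b') \<otimes> (u \<otimes> v) = (r \<otimes> b \<otimes> u) \<otimes> (r' \<otimes> b' \<otimes> v)"
      using c by (simp add: m_assoc m_comm m_lcomm)
    also have "\<dots> = (a \<otimes> a') \<otimes> (s \<otimes> s') \<otimes> (u \<otimes> v)"
      unfolding u(4) v(4) using c by (simp add: m_assoc m_comm m_lcomm)
    finally have "(a \<otimes> a', b \<otimes> b') \<in> fraction R S (r \<otimes> r') (s \<otimes> s')"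
      by (rule mem_fracI) (simp_all add: c)
    then show ?thesis
      by (rule frac_eqI) (simp_all add: c)
  qed
  then show ?thesis
    unfolding localization_def monoid.simps ring.simps
    by (rule UN_pairs_const[OF frac_refl[OF assms(1,2)] frac_refl[OF assms(3,4)]])
qed

lemma add_frac:
  assumes "r \<in> carrier R" "s \<in> S" "r' \<in> carrier R" "s' \<in> S"
  shows "fraction R S r s \<oplus>\<^bsub>localization R S\<^esub> fraction R S r' s' =
    fraction R S (r \<otimes> s' \<oplus> r' \<otimes> s) (s \<otimes> s')"
proof -
  have "fraction R S (a \<otimes> b' \<oplus> a' \<otimes> b) (b \<otimes> b') = fraction R S (r \<otimes> s' \<oplus> r' \<otimes> s) (s \<otimes> s')"
    if ab: "(a, b) \<in> fraction R S r s" "(a', b') \<in> fraction R S r' s'" for a b a' b'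
  proof -
    obtain u v where u: "a \<in> carrier R" "b \<in> S" "u \<in> S" "r \<otimes> b \<otimes> u = a \<otimes> s \<otimes> u"
      and v: "a' \<in> carrier R" "b' \<in> S" "v \<in> S" "r' \<otimes> b' \<otimes> v = a' \<otimes> s' \<otimes> v"
      using ab mem_frac[OF assms(1,2)] mem_frac[OF assms(3,4)] by blast
    note c = assms u(1-3) v(1-3) S_carrier m_closed S_mult a_closed
    have "(r \<otimes> s' \<oplus> r' \<otimes> s) \<otimes> (b \<otimes> b') \<otimes> (u \<otimes> v) =
        (r \<otimes> b \<otimes> u) \<otimes> (s' \<otimes> b' \<otimes> v) \<oplus> (r' \<otimes> b' \<otimes> v) \<otimes> (s \<otimes> b \<otimes> u)"
      using c by (simp add: l_distr r_distr m_assoc m_comm m_lcomm)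
    also have "\<dots> = (a \<otimes> b' \<oplus> a' \<otimes> b) \<otimes> (s \<otimes> s') \<otimes> (u \<otimes> v)"
      unfolding u(4) v(4) using c by (simp add: l_distr r_distr m_assoc m_comm m_lcomm)
    finally have "(a \<otimes> b' \<oplus> a' \<otimes> b, b \<otimes> b') \<in> fraction R S (r \<otimes> s' \<oplus> r' \<otimes> s) (s \<otimes> s')"
      by (rule mem_fracI) (simp_all add: c)
    then show ?thesis
      by (rule frac_eqI) (simp_all add: c)
  qed
  then show ?thesis
    unfolding localization_def monoid.simps ring.simps
    by (rule UN_pairs_const[OF frac_refl[OF assms(1,2)] frac_refl[OF assms(3,4)]])
qed

lemma one_frac:
  assumes "s \<in> S"
  shows "\<one>\<^bsub>localization R S\<^esub> = fraction R S s s"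
proof -
  have "fraction R S t t = fraction R S s s" if "t \<in> S" for t
  proof (rule frac_eqI)
    show "(t, t) \<in> fraction R S s s"
      using assms that by (intro mem_fracI[where u = s]) (simp_all add: S_carrier m_comm)
  qed (use assms in \<open>simp_all add: S_carrier\<close>)
  then have "(\<Union>t \<in> S. fraction R S t t) = (\<Union>t \<in> S. fraction R S s s)"
    by (intro SUP_cong refl)
  with assms show ?thesis
    unfolding localization_def monoid.simps by (metis UN_constant empty_iff)
qed

lemma zero_frac:
  assumes "s \<in> S"
  shows "\<zero>\<^bsub>localization R S\<^esub> = fraction R S \<zero> s"
proof -
  have "fraction R S \<zero> t = fraction R S \<zero> s" if "t \<in> S" for t
  proof (rule frac_eqI)
    show "(\<zero>, t) \<in> fraction R S \<zero> s"
      using assms that by (intro mem_fracI[where u = s]) (simp_all add: S_carrier l_null)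
  qed (use assms in simp_all)
  then have "(\<Union>t \<in> S. fraction R S \<zero> t) = (\<Union>t \<in> S. fraction R S \<zero> s)"
    by (intro SUP_cong refl)
  with assms show ?thesis
    unfolding localization_def ring.simps by (metis UN_constant empty_iff)
qed

end

end

theory Submission
  imports Defs
begin

text \<open>For \<open>a \<in> I\<close> with \<open>a \<noteq> 0\<close>, the idempotent \<open>e = a a\<^sup>(\<^sup>-\<^sup>1\<^sup>)\<close> is nonzero and has the same
  annihilator as \<open>a\<close>. Modulo \<open>Ann(e)\<close> the element \<open>e\<close> is an identity, so Zorn's lemma gives a
  maximal ideal \<open>\<mm> \<supseteq> Ann(e)\<close>. Then \<open>a/e = 0\<close> in the localization at \<open>\<mm>\<close> would provide some
  \<open>u \<notin> \<mm>\<close> annihilating \<open>a\<close>.\<close>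

context pseudoring
begin

lemma r_null: "x \<in> carrier R \<Longrightarrow> x \<otimes> \<zero> = \<zero>"
  by (metis l_null m_comm zero_closed)

lemma pseudo_idealI:
  assumes "J \<subseteq> carrier R" and "\<zero> \<in> J"
    and "\<And>x y. \<lbrakk>x \<in> J; y \<in> J\<rbrakk> \<Longrightarrow> x \<oplus> y \<in> J"
    and "\<And>x. x \<in> J \<Longrightarrow> \<ominus> x \<in> J"
    and "\<And>a x. \<lbrakk>a \<in> J; x \<in> carrier R\<rbrakk> \<Longrightarrow> x \<otimes> a \<in> J"
  shows "pseudo_ideal J R"
proof -
  have "additive_subgroup J R"
    using assms(1-4)
    by (intro additive_subgroup.intro add.subgroupI) (auto simp: a_inv_def)
  then show ?thesis
    by (intro pseudo_ideal.intro pseudo_ideal_axioms.intro pseudoring_axioms assms(5))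
qed

lemma pseudo_ideal_annihilator:
  assumes "a \<in> carrier R"
  shows "pseudo_ideal {x \<in> carrier R. x \<otimes> a = \<zero>} R"
  using assms by (intro pseudo_idealI) (auto simp: l_null r_null l_distr l_minus m_closed m_assoc)

lemma pseudo_ideal_subset: "pseudo_ideal J R \<Longrightarrow> J \<subseteq> carrier R"
  by (simp add: pseudo_ideal_def additive_subgroup.a_subset)

text \<open>Comparability is used only for sums: two elements of the union already lie in one common
  member. The other closure properties involve a single member, and \<open>C \<noteq> {}\<close>
  supplies zero.\<close>

lemma pseudo_ideal_Union_chain:
  assumes "C \<noteq> {}" and ideals: "\<And>J. J \<in> C \<Longrightarrow> pseudo_ideal J R"
    and chain: "\<And>J K. \<lbrakk>J \<in> C; K \<in> C\<rbrakk> \<Longrightarrow> J \<subseteq> K \<or> K \<subseteq> J"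
  shows "pseudo_ideal (\<Union>C) R"
proof -
  have sub: "additive_subgroup J R" if "J \<in> C" for J
    using ideals[OF that] by (simp add: pseudo_ideal_def)
  show ?thesis
  proof (rule pseudo_idealI)
    show "\<Union>C \<subseteq> carrier R"
      using ideals pseudo_ideal_subset by blast
    show "\<zero> \<in> \<Union>C"
      using assms(1) sub additive_subgroup.zero_closed by fastforce
    show "x \<oplus> y \<in> \<Union>C" if xy: "x \<in> \<Union>C" "y \<in> \<Union>C" for x y
    proof -
      obtain J K where "J \<in> C" "x \<in> J" "K \<in> C" "y \<in> K"
        using xy by blast
      with chain obtain L where "L \<in> C" "x \<in> L" "y \<in> L"
        by blast
      then show ?thesis
        using additive_subgroup.a_closed[OF sub] by blast
    qed
    show "\<ominus> x \<in> \<Union>C" if "x \<in> \<Union>C" for x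
      using that additive_subgroup.a_inv_closed[OF sub] by blast
    show "x \<otimes> a \<in> \<Union>C" if "a \<in> \<Union>C" "x \<in> carrier R" for a x
      using that pseudo_ideal.absorb[OF ideals] by blast
  qed
qed

text \<open>Without an identity, unions of chains of proper ideals may fail to be proper. Zorn's
  lemma is therefore applied to ideals omitting \<open>e\<close>, a condition that does pass to such
  unions.\<close>

lemma exists_maximal_pseudo_ideal_over_annihilator:
  assumes e: "e \<in> carrier R" "e \<otimes> e = e" "e \<noteq> \<zero>"
  obtains M where "M \<in> MaxSpec R" "e \<notin> M" "{x \<in> carrier R. x \<otimes> e = \<zero>} \<subseteq> M"
proof -
  let ?N = "{x \<in> carrier R. x \<otimes> e = \<zero>}"
  let ?A = "{J. pseudo_ideal J R \<and> ?N \<subseteq> J \<and> e \<notin> J}"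
  \<comment> \<open>Here \<open>e\<close> is outside its own annihilator because
    \<open>e \<otimes> e = e \<noteq> \<zero>\<close>.\<close>
  have "?N \<in> ?A"
    using e pseudo_ideal_annihilator by auto
  moreover have "\<Union>C \<in> ?A" if nonempty: "C \<noteq> {}" and chain: "subset.chain ?A C" for C
  proof -
    have C: "C \<subseteq> ?A"
      using chain by (simp add: subset_chain_def)
    have "pseudo_ideal (\<Union>C) R"
      using nonempty chain by (intro pseudo_ideal_Union_chain) (auto simp: subset_chain_def)
    moreover have "?N \<subseteq> \<Union>C"
    proof -
      obtain J where "J \<in> C"
        using nonempty by blast
      with C have "?N \<subseteq> J"
        by blast
      with \<open>J \<in> C\<close> show ?thesis
        by (meson Union_upper order_trans)
    qed
    moreover have "e \<notin> \<Union>C"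
      using C by blast
    ultimately show ?thesis
      by simp
  qed
  ultimately obtain M where M: "M \<in> ?A" and max: "\<forall>J \<in> ?A. M \<subseteq> J \<longrightarrow> J = M"
    using subset_Zorn_nonempty[of ?A] by blast
  have "J = M \<or> J = carrier R" if J: "pseudo_ideal J R" "M \<subseteq> J" for J
  proof (cases "e \<in> J")
    case False
    then show ?thesis
      using J M max by blast
  next
    case True
    \<comment> \<open>Split \<open>x\<close> along the idempotent:
      \<open>x \<ominus> x \<otimes> e\<close> annihilates \<open>e\<close>, so it lies in
      \<open>M\<close>, and \<open>x \<otimes> e\<close> is a multiple of \<open>e\<close>.\<close>
    have "x \<in> J" if x: "x \<in> carrier R" for x
    proof -
      have "(x \<ominus> x \<otimes> e) \<otimes> e = \<zero>"
        using x e by (simp add: minus_mult_eq_zero_iff m_closed m_assoc)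
      moreover have "x \<ominus> x \<otimes> e \<in> carrier R"
        using x e(1) by (simp add: a_minus_def m_closed)
      ultimately have "x \<ominus> x \<otimes> e \<in> J"
        using M J(2) by blast
      moreover have "x \<otimes> e \<in> J"
        using pseudo_ideal.absorb[OF J(1) True x] .
      moreover have "x = (x \<ominus> x \<otimes> e) \<oplus> x \<otimes> e"
        using x e by (simp add: a_minus_def a_assoc l_neg m_closed)
      ultimately show ?thesis
        using J(1) additive_subgroup.a_closed unfolding pseudo_ideal_def by metis
    qed
    then show ?thesis
      using J(1) pseudo_ideal_subset by blast
  qed
  then have "maximal_pseudo_ideal M R"
    using M e(1) by (intro maximal_pseudo_ideal.intro maximal_pseudo_ideal_axioms.intro) auto
  with M that show ?thesis
    by (simp add: MaxSpec_def)
qed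

text \<open>The equality of classes is tested on the single pair \<open>(\<zero>, s)\<close>, which
  belongs to the zero class since that is the union of all classes \<open>\<zero>/t\<close>.\<close>

lemma fraction_eq_zeroD:
  assumes "fraction R (carrier R - M) a s = \<zero>\<^bsub>localization_at R M\<^esub>"
    and "a \<in> carrier R" "s \<in> carrier R - M"
  obtains u where "u \<in> carrier R - M" "a \<otimes> s \<otimes> u = \<zero>"
proof -
  have "(\<zero>, s) \<in> fraction R (carrier R - M) \<zero> s"
    using assms(3) by (auto simp: fraction_def l_null minus_mult_eq_zero_iff)
  then have "(\<zero>, s) \<in> fraction R (carrier R - M) a s"
    using assms(1,3) by (auto simp: localization_at_def localization_def)
  with assms(2,3) that show thesis
    by (auto simp: fraction_def minus_mult_eq_zero_iff m_closed l_null)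
qed

end

theorem proposition5p5:
  fixes R :: "('a, 'b) ring_scheme" and I :: "'a set"
  assumes "pseudomeadow R"
    and "pseudo_ideal I R"
    and "\<And>M. M \<in> MaxSpec R \<Longrightarrow>
      ideal_localization_at R M I = {\<zero>\<^bsub>localization_at R M\<^esub>}"
  shows "I = {\<zero>\<^bsub>R\<^esub>}"
proof -
  interpret pseudomeadow R by fact
  interpret I: pseudo_ideal I R by fact
  have "a = \<zero>\<^bsub>R\<^esub>" if "a \<in> I" for a
  proof (rule ccontr)
    assume "a \<noteq> \<zero>\<^bsub>R\<^esub>"
    have a: "a \<in> carrier R"
      using that I.a_subset by blast
    then obtain b where b: "b \<in> carrier R" "a \<otimes>\<^bsub>R\<^esub> a \<otimes>\<^bsub>R\<^esub> b = a"
      using von_Neumann_inverse by blast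
    define e where "e = a \<otimes>\<^bsub>R\<^esub> b"
    have e: "e \<in> carrier R" and ae: "a \<otimes>\<^bsub>R\<^esub> e = a"
      using a b by (simp_all add: e_def m_closed m_assoc)
    \<comment> \<open>Absorb one factor \<open>e\<close> into \<open>a\<close>: \<open>(a \<otimes>
      b) \<otimes> e = (a \<otimes> e) \<otimes> b = a \<otimes> b\<close>.\<close>
    have "e \<otimes>\<^bsub>R\<^esub> e = e"
      using a b(1) e ae by (metis e_def m_assoc m_comm)
    moreover have "e \<noteq> \<zero>\<^bsub>R\<^esub>"
      using a ae \<open>a \<noteq> \<zero>\<^bsub>R\<^esub>\<close> r_null by metis
    ultimately obtain M where M: "M \<in> MaxSpec R" "e \<notin> M"
        "{x \<in> carrier R. x \<otimes>\<^bsub>R\<^esub> e = \<zero>\<^bsub>R\<^esub>} \<subseteq> M"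
      using exists_maximal_pseudo_ideal_over_annihilator[OF e] by blast
    \<comment> \<open>With no \<open>a/1\<close> at hand, \<open>e\<close> serves as denominator; it
      is admissible because \<open>e \<notin> M\<close>, and \<open>a \<otimes> e = a\<close> makes
      it harmless.\<close>
    have "fraction R (carrier R - M) a e \<in> ideal_localization_at R M I"
      using \<open>a \<in> I\<close> e M(2) by (auto simp: ideal_localization_at_def)
    then have "fraction R (carrier R - M) a e = \<zero>\<^bsub>localization_at R M\<^esub>"
      using assms(3)[OF M(1)] by simp
    then obtain u where u: "u \<in> carrier R - M" "a \<otimes>\<^bsub>R\<^esub> e \<otimes>\<^bsub>R\<^esub> u = \<zero>\<^bsub>R\<^esub>"
      using fraction_eq_zeroD[of M a e] a e M(2) by blast
    \<comment> \<open>Whatever kills \<open>a\<close> kills its multiple \<open>e\<close>, so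
      \<open>u\<close> falls into the annihilator of \<open>e\<close> and hence into
      \<open>M\<close>.\<close>
    have "u \<otimes>\<^bsub>R\<^esub> e = b \<otimes>\<^bsub>R\<^esub> (a \<otimes>\<^bsub>R\<^esub> u)"
      using a b(1) u(1) by (simp add: e_def m_assoc m_comm m_lcomm m_closed)
    then have "u \<otimes>\<^bsub>R\<^esub> e = \<zero>\<^bsub>R\<^esub>"
      using u(2) ae b(1) r_null by simp
    with M(3) u(1) show False
      by blast
  qed
  then show ?thesis
    using I.zero_closed by blast
qed

end
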